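(* Let $A$ be a unital complex Banach algebra and let $a\in A$ be such that its Moore-Penrose inverse $a^{\dag}$ exists. Then, for each one of the conditions (i)--(xx) below, $a$ is EP if and only if the group inverse $a^{\sharp}$ of $a$ exists and that condition holds: (i) $aa^{\dag}a^{\sharp}=a^{\dag}a^{\sharp}a$; (ii) $aa^{\dag}a^{\sharp}=a^{\sharp}aa^{\dag}$; (iii) $aa^{\sharp}a^{\dag}=a^{\dag}aa^{\sharp}$; (iv) $aa^{\sharp}a^{\dag}=a^{\sharp}a^{\dag}a$; (v) $a^{\dag}aa^{\sharp}=a^{\sharp}a^{\dag}a$; (vi) $(a^{\dag})^2a^{\sharp}=a^{\dag}a^{\sharp}a^{\dag}$; (vii) $aa^{\sharp}a^{\dag}=a^{\sharp}$; (viii) $a^{\dag}a^{\sharp}=a^{\sharp}a^{\dag}$; (ix) $a^{\dag}a^{\sharp}a^{\dag}=a^{\sharp}(a^{\dag})^2$; (x) $a^{\dag}(a^{\sharp})^2=a^{\sharp}a^{\dag}a^{\sharp}$; (xi) $a^{\dag}(a^{\sharp})^2=(a^{\sharp})^2a^{\dag}$; (xii) $(a^{\sharp})^2a^{\dag}=a^{\sharp}a^{\dag}a^{\sharp}$; (xiii) $aa^{\sharp}=a^{\dag}a$; (xiv) $a^{\dag}a^{\dag}=a^{\dag}a^{\sharp}$; (xv) $a^{\dag}a^{\dag}=a^{\sharp}a^{\dag}$; (xvi) $(a^{\dag})^2=(a^{\sharp})^2$; (xvii) $a^{\dag}a^{\sharp}=(a^{\sharp})^2$; (xviii) $a(a^{\dag})^2=a^{\sharp}$;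 (xix) $a^{\sharp}a^{\dag}a=a^{\dag}$; (xx) $a^{\dag}aa^{\sharp}=a^{\dag}$.
   Context: Let $A$ be a unital complex Banach algebra. An element $h\in A$ is hermitian if $\|\exp(ith)\|=1$ for all $t\in\mathbb{R}$. Given $a\in A$, an element $x\in A$ is the Moore-Penrose inverse of $a$, denoted $a^{\dag}$, if $a=axa$, $x=xax$, and both $ax$ and $xa$ are hermitian; there is at most one such $x$. An element $b\in A$ is the group inverse of $a$, denoted $a^{\sharp}$, if $a=aba$, $b=bab$ and $ab=ba$; it is unique if it exists. An element $a\in A$ is EP if $a^{\dag}$ exists and $aa^{\dag}=a^{\dag}a$. *)

theory Defs
  imports "HOL-Analysis.Analysis"
begin

text \<open>
  Requiring \<open>norm 1 = 1\<close> and \<open>0 \<noteq> 1\<close> (both part of \<open>real_normed_algebra_1\<close>) loses nothing here: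
  an algebra containing a hermitian element \<open>h\<close> satisfies them, because
  \<open>norm 1 = norm (exp (0 * h)) = 1\<close>.
\<close>

class complex_banach_algebra_1 = real_normed_algebra_1 + banach +
  fixes scaleC :: "complex \<Rightarrow> 'a \<Rightarrow> 'a" (infixr "*\<^sub>C" 75)
  assumes scaleC_add_right: "z *\<^sub>C (x + y) = z *\<^sub>C x + z *\<^sub>C y"
    and scaleC_add_left: "(z + w) *\<^sub>C x = z *\<^sub>C x + w *\<^sub>C x"
    and scaleC_scaleC: "z *\<^sub>C w *\<^sub>C x = (z * w) *\<^sub>C x"
    and scaleC_one: "1 *\<^sub>C x = x"
    and mult_scaleC_left: "z *\<^sub>C x * y = z *\<^sub>C (x * y)"
    and mult_scaleC_right: "x * z *\<^sub>C y = z *\<^sub>C (x * y)"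
    and norm_scaleC: "norm (z *\<^sub>C x) = cmod z * norm x"
    and scaleR_scaleC: "r *\<^sub>R x = complex_of_real r *\<^sub>C x"

instantiation complex :: complex_banach_algebra_1
begin

definition scaleC_complex :: "complex \<Rightarrow> complex \<Rightarrow> complex" where
  "scaleC_complex z x = z * x"

instance
  by standard (auto simp: scaleC_complex_def algebra_simps norm_mult scaleR_conv_of_real)

end

definition hermitian :: "'a::complex_banach_algebra_1 \<Rightarrow> bool" where
  "hermitian h \<longleftrightarrow> (\<forall>t::real. norm (exp ((\<i> * complex_of_real t) *\<^sub>C h)) = 1)"

text \<open>
  Both inverses are partial and unique when they exist, so they are rendered as relations:
  the second argument is an inverse of the first.
\<close>

definition is_MP_inverse :: "'a::complex_banach_algebra_1 \<Rightarrow> 'a \<Rightarrow> bool" where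
  "is_MP_inverse a x \<longleftrightarrow>
     a = a * x * a \<and> x = x * a * x \<and> hermitian (a * x) \<and> hermitian (x * a)"

definition is_group_inverse :: "'a::complex_banach_algebra_1 \<Rightarrow> 'a \<Rightarrow> bool" where
  "is_group_inverse a b \<longleftrightarrow> a = a * b * a \<and> b = b * a * b \<and> a * b = b * a"

definition EP :: "'a::complex_banach_algebra_1 \<Rightarrow> bool" where
  "EP a \<longleftrightarrow> (\<exists>x. is_MP_inverse a x \<and> a * x = x * a)"

end

theory Submission
  imports Defs
begin

text \<open>
  Write \<open>p = a * d\<close> and \<open>q = d * a\<close> for the two hermitian idempotents of the Moore-Penrose
  inverse \<open>d\<close>, and \<open>e = a * g = g * a\<close> for the idempotent of the group inverse \<open>g\<close>.
  Both \<open>p\<close> and \<open>e\<close> generate the right ideal of \<open>a\<close>, and both \<open>q\<close> and \<open>e\<close> generate its left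
  ideal; hence \<open>p * e = e\<close>, \<open>e * p = p\<close>, \<open>e * q = e\<close>, \<open>q * e = q\<close>.

  The only analytic input is that two hermitian idempotents with the same right ideal, or with the
  same left ideal, are equal (\<open>hermitian_idempotent_eqI_right\<close>,
  \<open>hermitian_idempotent_eqI_left\<close>). The reason is that
  \<open>exp (\<i> * pi * p) = 1 - 2 * p\<close> has norm one for a hermitian idempotent \<open>p\<close>. If \<open>p\<close> and
  \<open>q\<close> share an ideal, then \<open>p - q\<close> squares to zero and the contraction
  \<open>(1 - 2 * p) * (1 - 2 * q)\<close> is \<open>1\<close> plus \<open>2 * (p - q)\<close> or \<open>2 * (q - p)\<close>; its powers would
  grow linearly if \<open>p\<close> and \<open>q\<close> were different.

  It follows first that an EP element commutes with \<open>d\<close> itself, so that \<open>d\<close> is its group inverse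
  and every one of the conditions holds. It follows secondly that \<open>e = p\<close> forces
  \<open>p = q\<close>, because then \<open>p\<close> and \<open>q\<close> have the same left ideal, and that \<open>e = q\<close> forces the same.
  What remains is algebra in a monoid: each condition, after multiplication by suitable
  words in \<open>a\<close>, \<open>d\<close> and \<open>g\<close>, yields \<open>p = e\<close> or \<open>q = e\<close>.
\<close>

section \<open>Hermitian idempotents\<close>

lemma scaleR_scaleC_left:
  "(r *\<^sub>R z) *\<^sub>C x = r *\<^sub>R z *\<^sub>C (x :: 'a::complex_banach_algebra_1)"
  by (simp only: scaleR_scaleC[of r "z *\<^sub>C x"] scaleC_scaleC scaleR_conv_of_real[of r z])

lemma bounded_linear_scaleC_left:
  "bounded_linear (\<lambda>z. z *\<^sub>C (x :: 'a::complex_banach_algebra_1))"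
  by (rule bounded_linear_intro[where K = "norm x"])
    (simp_all add: scaleC_add_left norm_scaleC scaleR_scaleC_left)

lemma exp_scaleC_idempotent:
  fixes p :: "'a::complex_banach_algebra_1"
  assumes p: "p * p = p"
  shows "exp (c *\<^sub>C p) = 1 - p + exp c *\<^sub>C p"
proof -
  have pow: "(c *\<^sub>C p) ^ Suc n = (c ^ Suc n) *\<^sub>C p" for n
    by (induction n)
      (simp_all add: mult_scaleC_right mult_scaleC_left scaleC_scaleC p mult.commute
        mult.left_commute)
  let ?f = "\<lambda>n. (c *\<^sub>C p) ^ n /\<^sub>R fact n - (c ^ n /\<^sub>R fact n) *\<^sub>C p"
  have "(\<lambda>n. (c ^ n /\<^sub>R fact n) *\<^sub>C p) sums (exp c *\<^sub>C p)"
    by (rule bounded_linear.sums[OF bounded_linear_scaleC_left exp_converges])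
  from sums_diff[OF exp_converges this]
  have 1: "?f sums (exp (c *\<^sub>C p) - exp c *\<^sub>C p)" .
  \<comment> \<open>The two series differ in the constant term alone: \<open>1\<close> in one, \<open>p\<close> in the other.\<close>
  have "?f n = 0" if "n \<noteq> 0" for n
  proof -
    from that obtain m where "n = Suc m"
      by (cases n) auto
    then show ?thesis
      by (simp only: pow scaleR_scaleC_left diff_self)
  qed
  then have "?f sums (\<Sum>n\<in>{0}. ?f n)"
    by (intro sums_finite) auto
  then have "?f sums (1 - p)"
    by (simp add: scaleC_one)
  from sums_unique2[OF 1 this] show ?thesis
    by (simp add: algebra_simps)
qed

lemma norm_reflection_hermitian_idempotent:
  fixes p :: "'a::complex_banach_algebra_1"
  assumes "hermitian p" and "p * p = p"
  shows "norm (1 - 2 * p) = 1"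
proof -
  have "(- 1) *\<^sub>C p = - p"
    using scaleR_scaleC[of "- 1" p] by simp
  then have "exp ((\<i> * complex_of_real pi) *\<^sub>C p) = 1 - 2 * p"
    using exp_scaleC_idempotent[OF assms(2), of "\<i> * complex_of_real pi"]
    by (simp add: exp_pi_i' mult_2)
  moreover have "norm (exp ((\<i> * complex_of_real pi) *\<^sub>C p)) = 1"
    using assms(1) unfolding hermitian_def by blast
  ultimately show ?thesis
    by simp
qed

text \<open>
  The powers \<open>(1 + r) ^ n = 1 + n * r\<close> stay bounded only if \<open>r\<close> vanishes.
\<close>

lemma contraction_unipotent_eq_1:
  fixes r :: "'a::real_normed_algebra_1"
  assumes sq: "r * r = 0" and le: "norm (1 + r) \<le> 1"
  shows "r = 0"
proof (rule ccontr)
  assume "r \<noteq> 0"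
  have pow: "(1 + r) ^ n = 1 + real n *\<^sub>R r" for n
    by (induction n) (simp_all add: algebra_simps sq)
  have bound: "of_nat n * norm r \<le> 2" for n
  proof -
    have "of_nat n * norm r = norm ((1 + r) ^ n - 1)"
      by (simp add: pow)
    also have "\<dots> \<le> norm ((1 + r) ^ n) + norm (1 :: 'a)"
      by (rule norm_triangle_ineq4)
    also have "\<dots> \<le> norm (1 + r) ^ n + 1"
      by (simp add: norm_power_ineq)
    also have "\<dots> \<le> 2"
      using power_le_one[OF norm_ge_zero le, of n] by simp
    finally show ?thesis .
  qed
  obtain n where "2 < of_nat n * norm r"
    using reals_Archimedean3[of "norm r"] \<open>r \<noteq> 0\<close> by auto
  with bound[of n] show False
    by simp
qed

text \<open>
  The hypotheses of the next two lemmas say that \<open>p\<close> and \<open>q\<close> generate the same right, respectively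
  left, ideal. In either case all four products of \<open>p\<close> and \<open>q\<close> are \<open>p\<close> or \<open>q\<close>, so
  \<open>(p - q) * (p - q)\<close> cancels to zero, and the product of the two reflections is unipotent.
\<close>

lemma hermitian_idempotent_eqI_right:
  fixes p q :: "'a::complex_banach_algebra_1"
  assumes "hermitian p" "hermitian q" and pq: "p * q = q" and qp: "q * p = p"
  shows "p = q"
proof -
  have p: "p * p = p"
    using pq qp by (metis mult.assoc)
  have q: "q * q = q"
    using pq qp by (metis mult.assoc)
  have "norm ((1 - 2 * p) * (1 - 2 * q)) \<le> 1"
    using norm_mult_ineq[of "1 - 2 * p" "1 - 2 * q"] assms p q
    by (simp add: norm_reflection_hermitian_idempotent)
  also have "(1 - 2 * p) * (1 - 2 * q) = 1 + 2 *\<^sub>R (q - p)"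
    by (simp add: mult_2 scaleR_2 algebra_simps pq)
  finally have "2 *\<^sub>R (q - p) = 0"
    by (rule contraction_unipotent_eq_1[rotated]) (simp add: algebra_simps p q pq qp)
  then show ?thesis
    by simp
qed

lemma hermitian_idempotent_eqI_left:
  fixes p q :: "'a::complex_banach_algebra_1"
  assumes "hermitian p" "hermitian q" and pq: "p * q = p" and qp: "q * p = q"
  shows "p = q"
proof -
  have p: "p * p = p"
    using pq qp by (metis mult.assoc)
  have q: "q * q = q"
    using pq qp by (metis mult.assoc)
  have "norm ((1 - 2 * p) * (1 - 2 * q)) \<le> 1"
    using norm_mult_ineq[of "1 - 2 * p" "1 - 2 * q"] assms p q
    by (simp add: norm_reflection_hermitian_idempotent)
  also have "(1 - 2 * p) * (1 - 2 * q) = 1 + 2 *\<^sub>R (p - q)"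
    by (simp add: mult_2 scaleR_2 algebra_simps pq)
  finally have "2 *\<^sub>R (p - q) = 0"
    by (rule contraction_unipotent_eq_1[rotated]) (simp add: algebra_simps p q pq qp)
  then show ?thesis
    by simp
qed

section \<open>EP elements\<close>

lemma is_MP_inverseD:
  assumes "is_MP_inverse a x"
  shows "a * x * a = a" "x * a * x = x" "hermitian (a * x)" "hermitian (x * a)"
  using assms unfolding is_MP_inverse_def by metis+

lemma is_group_inverseD:
  assumes "is_group_inverse a g"
  shows "a * g * a = a" "g * a * g = g" "a * g = g * a"
  using assms unfolding is_group_inverse_def by metis+

text \<open>
  The definition of EP speaks of some Moore-Penrose inverse \<open>x\<close>. Since \<open>a * x\<close> and \<open>a * d\<close> have
  the same right ideal, and \<open>x * a\<close> and \<open>d * a\<close> the same left ideal, any other one will do.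
\<close>

lemma EP_iff_commute:
  fixes a d :: "'a::complex_banach_algebra_1"
  assumes d: "is_MP_inverse a d"
  shows "EP a \<longleftrightarrow> a * d = d * a"
proof
  assume "EP a"
  then obtain x where x: "is_MP_inverse a x" and comm: "a * x = x * a"
    unfolding EP_def by blast
  note D = is_MP_inverseD[OF d] and X = is_MP_inverseD[OF x]
  have "a * d = a * x"
    by (rule hermitian_idempotent_eqI_right[OF D(3) X(3)]) (simp_all add: D X flip: mult.assoc)
  moreover have "d * a = x * a"
    using D(1) X(1)
    by (intro hermitian_idempotent_eqI_left[OF D(4) X(4)]) (simp_all add: mult.assoc)
  ultimately show "a * d = d * a"
    using comm by simp
next
  assume "a * d = d * a"
  with d show "EP a"
    unfolding EP_def by blast
qed

lemma EP_if_group_idempotent_eq: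
  fixes a d g :: "'a::complex_banach_algebra_1"
  assumes d: "is_MP_inverse a d" and g: "is_group_inverse a g"
    and e: "a * d = a * g \<or> d * a = a * g"
  shows "EP a"
proof -
  have herm: "hermitian (a * d)" "hermitian (d * a)" and ada: "a * d * a = a"
    by (fact is_MP_inverseD[OF d])+
  have aga: "a * g * a = a" and comm: "a * g = g * a"
    by (fact is_group_inverseD[OF g])+
  have pe: "a * d * (a * g) = a * g" and ep: "a * g * (a * d) = a * d"
    using ada aga by (simp_all flip: mult.assoc)
  have eq: "a * g * (d * a) = a * g" and qe: "d * a * (a * g) = d * a"
    unfolding comm using ada aga by (simp_all add: mult.assoc)
  from e have "a * d = d * a"
  proof
    assume e: "a * d = a * g"
    show ?thesis
      by (rule hermitian_idempotent_eqI_left[OF herm]) (simp_all only: e eq qe)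
  next
    assume e: "d * a = a * g"
    show ?thesis
      by (rule hermitian_idempotent_eqI_right[OF herm]) (simp_all only: e pe ep)
  qed
  then show ?thesis
    using EP_iff_commute[OF d] by blast
qed

text \<open>
  This separates the analysis from the algebra: for a particular condition \<open>P\<close> on the group
  inverse, both remaining premises are statements about words in a monoid.
\<close>

lemma EP_iff_group_inverse:
  fixes a d :: "'a::complex_banach_algebra_1"
  assumes d: "is_MP_inverse a d"
    and EP_imp: "\<lbrakk>a * d * a = a; d * a * d = d; d * a = a * d\<rbrakk> \<Longrightarrow> P d"
    and imp_eq: "\<And>g. \<lbrakk>is_group_inverse a g; P g\<rbrakk> \<Longrightarrow> a * d = a * g \<or> d * a = a * g"
  shows "EP a \<longleftrightarrow> (\<exists>g. is_group_inverse a g \<and> P g)"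
proof
  assume "EP a"
  then have comm: "a * d = d * a"
    using EP_iff_commute[OF d] by blast
  with d have "is_group_inverse a d"
    unfolding is_group_inverse_def is_MP_inverse_def by blast
  moreover have "P d"
    by (intro EP_imp is_MP_inverseD(1,2)[OF d] comm[symmetric])
  ultimately show "\<exists>g. is_group_inverse a g \<and> P g"
    by blast
next
  assume "\<exists>g. is_group_inverse a g \<and> P g"
  then show "EP a"
    using EP_if_group_idempotent_eq[OF d] imp_eq by blast
qed

section \<open>Reduction of the conditions\<close>

text \<open>
  Here \<open>d\<close> is any reflexive generalized inverse of \<open>a\<close>. The rules \<open>reduce\<close> move \<open>a\<close> to the left
  past \<open>g\<close>, delete \<open>p\<close> and \<open>q\<close> where an ideal absorbs them, and cancel \<open>a\<close> against \<open>g\<close>;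
  between two factors \<open>g\<close>, the inverse \<open>d\<close> turns into \<open>g\<close>.
  The instances with a trailing \<open>z\<close> make them work inside right-nested products.
\<close>

context
  fixes a d g :: "'a::monoid_mult"
  assumes ada: "a * d * a = a" and dad: "d * a * d = d"
    and aga: "a * g * a = a" and gag: "g * a * g = g" and comm: "a * g = g * a"
begin

lemma reduce:
  "g * a = a * g" "g * (a * z) = a * (g * z)"
  "a * (a * g) = a" "a * (a * (g * z)) = a * z"
  "a * (g * g) = g" "a * (g * (g * z)) = g * z"
  "a * (d * a) = a" "a * (d * (a * z)) = a * z"
  "d * (a * d) = d" "d * (a * (d * z)) = d * z"
  "a * (d * g) = g" "a * (d * (g * z)) = g * z"
  "g * (d * a) = g" "g * (d * (a * z)) = g * z"
  "g * (d * g) = g * (g * g)" "g * (d * (g * z)) = g * (g * (g * z))"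
proof -
  have aag: "a * (a * g) = a"
    unfolding comm using aga by (simp add: mult.assoc)
  have agg: "a * (g * g) = g"
    using gag by (simp add: comm flip: mult.assoc)
  have gga: "g * (g * a) = g"
    unfolding comm[symmetric] using gag by (simp add: mult.assoc)
  \<comment> \<open>Since \<open>g = a * (g * g) = (g * g) * a\<close>, it inherits the absorption laws of \<open>a\<close>.\<close>
  have "a * (d * (a * (g * g))) = a * (g * g)"
    using ada by (simp flip: mult.assoc)
  then have adg: "a * (d * g) = g"
    by (simp add: agg)
  have "(g * g * a) * (d * a) = g * g * a"
    using ada by (simp add: mult.assoc)
  then have gda: "g * (d * a) = g"
    by (simp add: gga mult.assoc)
  have "g * (d * a) * (g * g) = g * (g * g)"
    by (simp only: gda)
  then have gdg: "g * (d * g) = g * (g * g)"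
    by (simp add: mult.assoc agg)
  show "g * a = a * g" "g * (a * z) = a * (g * z)"
    using comm by (simp_all flip: mult.assoc)
  show "a * (a * g) = a" "a * (a * (g * z)) = a * z"
    using aag by (simp_all flip: mult.assoc)
  show "a * (g * g) = g" "a * (g * (g * z)) = g * z"
    using agg by (simp_all flip: mult.assoc)
  show "a * (d * a) = a" "a * (d * (a * z)) = a * z"
    using ada by (simp_all flip: mult.assoc)
  show "d * (a * d) = d" "d * (a * (d * z)) = d * z"
    using dad by (simp_all flip: mult.assoc)
  show "a * (d * g) = g" "a * (d * (g * z)) = g * z"
    using adg by (simp_all flip: mult.assoc)
  show "g * (d * a) = g" "g * (d * (a * z)) = g * z"
    using gda by (simp_all flip: mult.assoc)
  show "g * (d * g) = g * (g * g)" "g * (d * (g * z)) = g * (g * (g * z))"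
    using gdg by (simp_all flip: mult.assoc)
qed

text \<open>
  Most conditions give \<open>p = e\<close> on multiplying by powers of \<open>a\<close> from the left. The others
  equate a word that ends in \<open>g\<close>, and so is fixed by right multiplication with \<open>e\<close>, with a word that ends in
  \<open>d\<close>. Then \<open>e\<close> fixes the latter as well, where \<open>g * d * e = g * g\<close> turns its final \<open>d\<close>
  into \<open>g\<close>, and cancelling on the left gives \<open>p = e\<close>. The same works with \<open>p\<close> in place of
  \<open>e\<close>: if a word that ends in \<open>d\<close> equals \<open>g\<close>, then \<open>g * p = g\<close>.
\<close>

lemma range_idempotent_eq:
  "a * d * g = g * a * d \<Longrightarrow> a * d = a * g"
  "a * g * d = d * a * g \<Longrightarrow> a * d = a * g"
  "a * g * d = g * d * a \<Longrightarrow> a * d = a * g"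
  "d\<^sup>2 * g = d * g * d \<Longrightarrow> a * d = a * g"
  "a * g * d = g \<Longrightarrow> a * d = a * g"
  "d * g = g * d \<Longrightarrow> a * d = a * g"
  "g\<^sup>2 * d = g * d * g \<Longrightarrow> a * d = a * g"
  "d * d = d * g \<Longrightarrow> a * d = a * g"
  "a * d\<^sup>2 = g \<Longrightarrow> a * d = a * g"
  "g * d * a = d \<Longrightarrow> a * d = a * g"
  "d * a * g = d \<Longrightarrow> a * d = a * g"
proof -
  show "a * d = a * g" if E: "a * d * g = g * a * d"
    using arg_cong[OF E, of "\<lambda>x. a * x"]
    by (simp add: reduce mult.assoc power2_eq_square)
  show "a * d = a * g" if E: "a * g * d = d * a * g"
    using arg_cong[OF E, of "\<lambda>x. a * x"]
    by (simp add: reduce mult.assoc power2_eq_square)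
  show "a * d = a * g" if E: "a * g * d = g * d * a"
    using arg_cong[OF E, of "\<lambda>x. a * x"]
    by (simp add: reduce mult.assoc power2_eq_square)
  show "a * d = a * g" if E: "d\<^sup>2 * g = d * g * d"
  proof -
    have step: "a * d * d * g = g * d"
      using arg_cong[OF E, of "\<lambda>x. a * x"]
      by (simp add: reduce mult.assoc power2_eq_square)
    have fixed: "g * d = g * g"
      using arg_cong[OF step, of "\<lambda>x. x * a * g"] step
      by (simp add: reduce mult.assoc power2_eq_square)
    show ?thesis
      using arg_cong[OF fixed, of "\<lambda>x. a * a * x"]
      by (simp add: reduce mult.assoc power2_eq_square)
  qed
  show "a * d = a * g" if E: "a * g * d = g"
    using arg_cong[OF E, of "\<lambda>x. a * x"]
    by (simp add: reduce mult.assoc power2_eq_square)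
  show "a * d = a * g" if E: "d * g = g * d"
  proof -
    have step: "d * g = g * g"
      using arg_cong[OF E, of "\<lambda>x. x * a * g"]
      by (simp add: reduce mult.assoc power2_eq_square)
    have fixed: "g * d = g * g"
      using E step by simp
    show ?thesis
      using arg_cong[OF fixed, of "\<lambda>x. a * a * x"]
      by (simp add: reduce mult.assoc power2_eq_square)
  qed
  show "a * d = a * g" if E: "g\<^sup>2 * d = g * d * g"
    using arg_cong[OF E, of "\<lambda>x. a * a * a * x"]
    by (simp add: reduce mult.assoc power2_eq_square)
  show "a * d = a * g" if E: "d * d = d * g"
  proof -
    have step: "a * d * d = g"
      using arg_cong[OF E, of "\<lambda>x. a * x"]
      by (simp add: reduce mult.assoc power2_eq_square)
    have fixed: "g * a * d = g"
      using arg_cong[OF step, of "\<lambda>x. x * a * d"] step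
      by (simp add: reduce mult.assoc power2_eq_square)
    show ?thesis
      using arg_cong[OF fixed, of "\<lambda>x. a * x"]
      by (simp add: reduce mult.assoc power2_eq_square)
  qed
  show "a * d = a * g" if E: "a * d\<^sup>2 = g"
  proof -
    have step: "a * d * d = g"
      using E by (simp add: reduce mult.assoc power2_eq_square)
    have fixed: "g * a * d = g"
      using arg_cong[OF step, of "\<lambda>x. x * a * d"] step
      by (simp add: reduce mult.assoc power2_eq_square)
    show ?thesis
      using arg_cong[OF fixed, of "\<lambda>x. a * x"]
      by (simp add: reduce mult.assoc power2_eq_square)
  qed
  show "a * d = a * g" if E: "g * d * a = d"
    using arg_cong[OF E, of "\<lambda>x. a * x"]
    by (simp add: reduce mult.assoc power2_eq_square)
  show "a * d = a * g" if E: "d * a * g = d"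
    using arg_cong[OF E, of "\<lambda>x. a * x"]
    by (simp add: reduce mult.assoc power2_eq_square)
qed

text \<open>
  This is the mirror image. Where multiplying by powers of \<open>a\<close> from the right is not enough, a word that
  begins with \<open>g\<close> or \<open>d\<close>, hence is fixed by left multiplication with \<open>e\<close> or \<open>q\<close>, equals one
  that begins with the other letter; the fixed property passes to the latter, and cancelling
  on the right leaves \<open>q = e\<close>.
\<close>

lemma corange_idempotent_eq:
  "a * d * g = d * g * a \<Longrightarrow> d * a = a * g"
  "d * a * g = g * d * a \<Longrightarrow> d * a = a * g"
  "d * g * d = g * d\<^sup>2 \<Longrightarrow> d * a = a * g"
  "d * g\<^sup>2 = g * d * g \<Longrightarrow> d * a = a * g"
  "d * g\<^sup>2 = g\<^sup>2 * d \<Longrightarrow> d * a = a * g"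
  "a * g = d * a \<Longrightarrow> d * a = a * g"
  "d * d = g * d \<Longrightarrow> d * a = a * g"
  "d\<^sup>2 = g\<^sup>2 \<Longrightarrow> d * a = a * g"
  "d * g = g\<^sup>2 \<Longrightarrow> d * a = a * g"
proof -
  show "d * a = a * g" if E: "a * d * g = d * g * a"
    using arg_cong[OF E, of "\<lambda>x. x * a"]
    by (simp add: reduce mult.assoc power2_eq_square)
  show "d * a = a * g" if E: "d * a * g = g * d * a"
    using arg_cong[OF E, of "\<lambda>x. x * a"]
    by (simp add: reduce mult.assoc power2_eq_square)
  show "d * a = a * g" if E: "d * g * d = g * d\<^sup>2"
  proof -
    have step: "d * g = g * d * d * a"
      using arg_cong[OF E, of "\<lambda>x. x * a"]
      by (simp add: reduce mult.assoc power2_eq_square)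
    have fixed: "a * g * d * g = d * g"
      using arg_cong[OF step, of "\<lambda>x. a * g * x"] step
      by (simp add: reduce mult.assoc power2_eq_square)
    show ?thesis
      using arg_cong[OF fixed, of "\<lambda>x. x * a * a"]
      by (simp add: reduce mult.assoc power2_eq_square)
  qed
  show "d * a = a * g" if E: "d * g\<^sup>2 = g * d * g"
    using arg_cong[OF E, of "\<lambda>x. x * a * a * a"]
    by (simp add: reduce mult.assoc power2_eq_square)
  show "d * a = a * g" if E: "d * g\<^sup>2 = g\<^sup>2 * d"
  proof -
    have fixed: "a * g * d * g * g = d * g * g"
      using arg_cong[OF E, of "\<lambda>x. a * g * x"] E
      by (simp add: reduce mult.assoc power2_eq_square)
    show ?thesis
      using arg_cong[OF fixed, of "\<lambda>x. x * a * a * a"]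
      by (simp add: reduce mult.assoc power2_eq_square)
  qed
  show "d * a = a * g" if E: "a * g = d * a"
    using E by simp
  show "d * a = a * g" if E: "d * d = g * d"
  proof -
    have step: "d * d * a = g"
      using arg_cong[OF E, of "\<lambda>x. x * a"]
      by (simp add: reduce mult.assoc power2_eq_square)
    have fixed: "d * a * g = g"
      using arg_cong[OF step, of "\<lambda>x. d * a * x"] step
      by (simp add: reduce mult.assoc power2_eq_square)
    show ?thesis
      using arg_cong[OF fixed, of "\<lambda>x. x * a"]
      by (simp add: reduce mult.assoc power2_eq_square)
  qed
  show "d * a = a * g" if E: "d\<^sup>2 = g\<^sup>2"
  proof -
    have fixed: "d * a * g * g = g * g"
      using arg_cong[OF E, of "\<lambda>x. d * a * x"] E
      by (simp add: reduce mult.assoc power2_eq_square)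
    show ?thesis
      using arg_cong[OF fixed, of "\<lambda>x. x * a * a"]
      by (simp add: reduce mult.assoc power2_eq_square)
  qed
  show "d * a = a * g" if E: "d * g = g\<^sup>2"
  proof -
    have fixed: "d * a * g * g = g * g"
      using arg_cong[OF E, of "\<lambda>x. d * a * x"] E
      by (simp add: reduce mult.assoc power2_eq_square)
    show ?thesis
      using arg_cong[OF fixed, of "\<lambda>x. x * a * a"]
      by (simp add: reduce mult.assoc power2_eq_square)
  qed
qed

end

text \<open>
  When \<open>a\<close> and \<open>d\<close> commute, \<open>d\<close> itself serves as the group inverse, and both sides of each
  condition are equal words in commuting letters once \<open>a * d * a = a\<close> and \<open>d * a * d = d\<close>
  are applied.
\<close>

lemma commuting_words:
  fixes a d :: "'a::monoid_mult"
  assumes "a * d * a = a" "d * a * d = d" "d * a = a * d"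
  shows "d * a = a * d" "d * (a * z) = a * (d * z)" "a * (d * d) = d"
  using assms by (simp_all flip: mult.assoc)

theorem theorem2p2:
  fixes a d :: "'a::complex_banach_algebra_1"
  assumes "is_MP_inverse a d"
  shows
    "(EP a \<longleftrightarrow> (\<exists>g. is_group_inverse a g \<and> a * d * g = d * g * a)) \<and>
     (EP a \<longleftrightarrow> (\<exists>g. is_group_inverse a g \<and> a * d * g = g * a * d)) \<and>
     (EP a \<longleftrightarrow> (\<exists>g. is_group_inverse a g \<and> a * g * d = d * a * g)) \<and>
     (EP a \<longleftrightarrow> (\<exists>g. is_group_inverse a g \<and> a * g * d = g * d * a)) \<and>
     (EP a \<longleftrightarrow> (\<exists>g. is_group_inverse a g \<and> d * a * g = g * d * a)) \<and>
     (EP a \<longleftrightarrow> (\<exists>g. is_group_inverse a g \<and> d^2 * g = d * g * d)) \<and>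
     (EP a \<longleftrightarrow> (\<exists>g. is_group_inverse a g \<and> a * g * d = g)) \<and>
     (EP a \<longleftrightarrow> (\<exists>g. is_group_inverse a g \<and> d * g = g * d)) \<and>
     (EP a \<longleftrightarrow> (\<exists>g. is_group_inverse a g \<and> d * g * d = g * d^2)) \<and>
     (EP a \<longleftrightarrow> (\<exists>g. is_group_inverse a g \<and> d * g^2 = g * d * g)) \<and>
     (EP a \<longleftrightarrow> (\<exists>g. is_group_inverse a g \<and> d * g^2 = g^2 * d)) \<and>
     (EP a \<longleftrightarrow> (\<exists>g. is_group_inverse a g \<and> g^2 * d = g * d * g)) \<and>
     (EP a \<longleftrightarrow> (\<exists>g. is_group_inverse a g \<and> a * g = d * a)) \<and>
     (EP a \<longleftrightarrow> (\<exists>g. is_group_inverse a g \<and> d * d = d * g)) \<and>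
     (EP a \<longleftrightarrow> (\<exists>g. is_group_inverse a g \<and> d * d = g * d)) \<and>
     (EP a \<longleftrightarrow> (\<exists>g. is_group_inverse a g \<and> d^2 = g^2)) \<and>
     (EP a \<longleftrightarrow> (\<exists>g. is_group_inverse a g \<and> d * g = g^2)) \<and>
     (EP a \<longleftrightarrow> (\<exists>g. is_group_inverse a g \<and> a * d^2 = g)) \<and>
     (EP a \<longleftrightarrow> (\<exists>g. is_group_inverse a g \<and> g * d * a = d)) \<and>
     (EP a \<longleftrightarrow> (\<exists>g. is_group_inverse a g \<and> d * a * g = d))"
proof -
  note d = is_MP_inverseD(1,2)[OF assms]
  note words = commuting_words[OF d]
  note imp_eq = range_idempotent_eq[OF d is_group_inverseD]
    corange_idempotent_eq[OF d is_group_inverseD]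
  \<comment> \<open>For each condition, \<open>blast\<close> derives \<open>p = e\<close> or \<open>q = e\<close>, and \<open>simp\<close> checks it at \<open>g = d\<close>.\<close>
  show ?thesis
    by (intro conjI EP_iff_group_inverse[OF assms];
        (blast dest: imp_eq | simp add: words mult.assoc power2_eq_square))
qed

end
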